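(* Let $m:\mathbb{R}^d\to\mathbb{R}$ be the time-constant of first-passage percolation with stationary-ergodic edge-weights $\tau$ satisfying $0<a\le \tau\le b<\infty$, and let $\overline{H}:\mathbb{R}^d\to\mathbb{R}$ be the associated limiting (homogenized) Hamiltonian. Then $m$ solves, in the viscosity sense, the Hamilton–Jacobi equation $$\overline{H}(Dm(x)) = 1 \quad (x\in\mathbb{R}^d\setminus\{0\}),\qquad m(0)=0 .$$
   Context: Let $d\ge 1$, $A=\{\pm e_1,\dots,\pm e_d\}$ with $e_i$ the canonical basis of $\mathbb{Z}^d$, and $(\Omega,\mathcal{F},\mathbb{P})$ a probability space with invertible measure-preserving maps $\{V_z\}_{z\in\mathbb{Z}^d}$, $V_{z+w}=V_z\circ V_w$, that are ergodic (every event $B$ with $V_zB=B$ for every $z$ has probability $0$ or $1$). The edge-weights $\tau:\mathbb{Z}^d\times A\times\Omega\to\mathbb{R}$ ($\tau(x,\alpha,\omega)$ is the weight of the directed edge from $x$ to $x+\alpha$) are stationary: $\tau(x+z,\alpha,\omega)=\tau(x,\alpha,V_z\omega)$ for all $x,z\in\mathbb{Z}^d$, and $0<a=\operatorname{ess\,inf}_{x,\alpha,\omega}\tau$, $b=\operatorname{ess\,sup}_{x,\alpha,\omega}\tau<\infty$. First-passage time: for a nearest-neighbour path $\gamma=(v_1,\dots,v_n)$ from $v_1=x$ to $v_n=y$ put $\mathcal{W}(\gamma)=\sum_{i=1}^{n-1}\tau(v_i,v_{i+1}-v_i,\omega)$; $\mathcal{T}(x,y)=\inf_\gamma\mathcal{W}(\gamma)$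 over all such paths, and $\mathcal{T}(x)=\mathcal{T}(x,0)$. The time-constant is $m(x)=\lim_{n\to\infty}\mathcal{T}([nx])/n$ for $x\in\mathbb{R}^d$ (the a.s. deterministic limit, which exists), where $[y]$ is the closest lattice point to $y$ (ties broken uniformly). Limiting Hamiltonian: for $p\in\mathbb{R}^d$, $x\in\mathbb{Z}^d$, $t\ge 0$ let $\mu_p(x,t)$ be the infimum, over all integers $k\ge0$ and all nearest-neighbour paths $x=v_0,v_1,\dots,v_k$ with $\sum_{i=0}^{k-1}\tau(v_i,v_{i+1}-v_i,\omega)\le t$, of $\sum_{i=0}^{k-1}p\cdot(v_{i+1}-v_i)$. Then $\overline{H}(p)=-\lim_{t\to\infty}\mu_p(0,t)/t$ (the a.s. deterministic limit, which exists). *)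

theory Defs
  imports "HOL-Probability.Probability"
begin

section \<open>Stationary ergodic edge weights\<close>

definition directions :: "(int ^ 'd) set" where
  "directions = range (\<lambda>i. axis i 1) \<union> range (\<lambda>i. - axis i 1)"

definition latvec :: "int ^ 'd \<Rightarrow> real ^ 'd" where
  "latvec z = (\<chi> i. real_of_int (z $ i))"

text \<open>An invertible, measure-preserving, ergodic action \<open>V\<close> of the lattice. Each \<open>V z\<close> need
  only be assumed measurable: its inverse is \<open>V (- z)\<close>.\<close>

locale ergodic_lattice_action = prob_space M
  for M :: "'w measure" +
  fixes V :: "int ^ 'd::finite \<Rightarrow> 'w \<Rightarrow> 'w"
  assumes V_measurable: "\<And>z. V z \<in> measurable M M"
    and V_invertible: "\<And>z. bij_betw (V z) (space M) (space M)"
    and V_preserving: "\<And>z. distr M M (V z) = M"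
    and V_add: "\<And>z w \<omega>. \<omega> \<in> space M \<Longrightarrow> V (z + w) \<omega> = V z (V w \<omega>)"
    and V_ergodic: "\<And>B. B \<in> events \<Longrightarrow> (\<And>z. V z ` B = B) \<Longrightarrow> prob B = 0 \<or> prob B = 1"

text \<open>\<open>\<tau> x \<alpha> \<omega>\<close> is the weight of the directed edge from \<open>x\<close> to \<open>x + \<alpha>\<close>; its values for
  \<open>\<alpha> \<notin> directions\<close> are irrelevant.\<close>

locale stationary_ergodic_weights = ergodic_lattice_action M V
  for M :: "'w measure" and V :: "int ^ 'd::finite \<Rightarrow> 'w \<Rightarrow> 'w" +
  fixes \<tau> :: "int ^ 'd \<Rightarrow> int ^ 'd \<Rightarrow> 'w \<Rightarrow> real"
  assumes \<tau>_measurable: "\<And>x \<alpha>. \<alpha> \<in> directions \<Longrightarrow> \<tau> x \<alpha> \<in> borel_measurable M"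
    and \<tau>_stationary:
      "\<And>x z \<alpha> \<omega>. \<alpha> \<in> directions \<Longrightarrow> \<omega> \<in> space M \<Longrightarrow> \<tau> (x + z) \<alpha> \<omega> = \<tau> x \<alpha> (V z \<omega>)"

text \<open>The essential bounds are taken jointly in \<open>(x, \<alpha>, \<omega>)\<close>, with counting measure on the edges.\<close>

definition edge_measure :: "'w measure \<Rightarrow> ((int ^ 'd) \<times> (int ^ 'd) \<times> 'w) measure" where
  "edge_measure M = count_space UNIV \<Otimes>\<^sub>M (count_space directions \<Otimes>\<^sub>M M)"

definition weight_esssup ::
  "'w measure \<Rightarrow> (int ^ 'd \<Rightarrow> int ^ 'd \<Rightarrow> 'w \<Rightarrow> real) \<Rightarrow> ereal" where
  "weight_esssup M \<tau> = esssup (edge_measure M) (\<lambda>(x, \<alpha>, \<omega>). ereal (\<tau> x \<alpha> \<omega>))"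

definition weight_essinf ::
  "'w measure \<Rightarrow> (int ^ 'd \<Rightarrow> int ^ 'd \<Rightarrow> 'w \<Rightarrow> real) \<Rightarrow> ereal" where
  "weight_essinf M \<tau> = - esssup (edge_measure M) (\<lambda>(x, \<alpha>, \<omega>). - ereal (\<tau> x \<alpha> \<omega>))"


section \<open>First-passage time and time constant\<close>

definition nn_path :: "(int ^ 'd) list \<Rightarrow> bool" where
  "nn_path \<gamma> \<longleftrightarrow> \<gamma> \<noteq> [] \<and> (\<forall>i. Suc i < length \<gamma> \<longrightarrow> \<gamma> ! Suc i - \<gamma> ! i \<in> directions)"

definition path_weight ::
  "(int ^ 'd \<Rightarrow> int ^ 'd \<Rightarrow> 'w \<Rightarrow> real) \<Rightarrow> 'w \<Rightarrow> (int ^ 'd) list \<Rightarrow> real" where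
  "path_weight \<tau> \<omega> \<gamma> = (\<Sum>i<length \<gamma> - 1. \<tau> (\<gamma> ! i) (\<gamma> ! Suc i - \<gamma> ! i) \<omega>)"

definition passage_time ::
  "(int ^ 'd \<Rightarrow> int ^ 'd \<Rightarrow> 'w \<Rightarrow> real) \<Rightarrow> 'w \<Rightarrow> int ^ 'd \<Rightarrow> int ^ 'd \<Rightarrow> real" where
  "passage_time \<tau> \<omega> x y =
     Inf {path_weight \<tau> \<omega> \<gamma> | \<gamma>. nn_path \<gamma> \<and> hd \<gamma> = x \<and> last \<gamma> = y}"

text \<open>A closest-lattice-point map, with an arbitrary rule for breaking ties.\<close>

definition closest_lattice_point :: "(real ^ 'd \<Rightarrow> int ^ 'd) \<Rightarrow> bool" where
  "closest_lattice_point r \<longleftrightarrow> (\<forall>y z. dist y (latvec (r y)) \<le> dist y (latvec z))"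

text \<open>\<open>m\<close> is the almost sure deterministic limit defining the time constant; since almost sure
  limits on a probability space are unique, this determines \<open>m\<close>. The passage is from \<open>[nx]\<close> to
  the origin.\<close>

definition is_time_constant ::
  "'w measure \<Rightarrow> (int ^ 'd \<Rightarrow> int ^ 'd \<Rightarrow> 'w \<Rightarrow> real) \<Rightarrow> (real ^ 'd \<Rightarrow> int ^ 'd) \<Rightarrow>
     (real ^ 'd \<Rightarrow> real) \<Rightarrow> bool" where
  "is_time_constant M \<tau> r m \<longleftrightarrow>
     (\<forall>x. AE \<omega> in M. (\<lambda>n. passage_time \<tau> \<omega> (r (real n *\<^sub>R x)) 0 / real n) \<longlonglongrightarrow> m x)"


section \<open>The limiting Hamiltonian\<close>

definition path_value :: "real ^ 'd \<Rightarrow> (int ^ 'd) list \<Rightarrow> real" where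
  "path_value p \<gamma> = (\<Sum>i<length \<gamma> - 1. p \<bullet> latvec (\<gamma> ! Suc i - \<gamma> ! i))"

definition finite_time_value ::
  "(int ^ 'd \<Rightarrow> int ^ 'd \<Rightarrow> 'w \<Rightarrow> real) \<Rightarrow> 'w \<Rightarrow> real ^ 'd \<Rightarrow> int ^ 'd \<Rightarrow> real \<Rightarrow> real" where
  "finite_time_value \<tau> \<omega> p x t =
     Inf {path_value p \<gamma> | \<gamma>. nn_path \<gamma> \<and> hd \<gamma> = x \<and> path_weight \<tau> \<omega> \<gamma> \<le> t}"

definition is_limiting_hamiltonian ::
  "'w measure \<Rightarrow> (int ^ 'd \<Rightarrow> int ^ 'd \<Rightarrow> 'w \<Rightarrow> real) \<Rightarrow> (real ^ 'd \<Rightarrow> real) \<Rightarrow> bool" where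
  "is_limiting_hamiltonian M \<tau> H \<longleftrightarrow>
     (\<forall>p. AE \<omega> in M. ((\<lambda>t. - (finite_time_value \<tau> \<omega> p 0 t / t)) \<longlongrightarrow> H p) at_top)"


section \<open>Viscosity solutions\<close>

text \<open>Solutions of \<open>F(x, u, Du) = 0\<close> on the open set \<open>U\<close>, with continuously differentiable test
  functions.\<close>

definition C1_with_gradient ::
  "'a::real_inner set \<Rightarrow> ('a \<Rightarrow> real) \<Rightarrow> ('a \<Rightarrow> 'a) \<Rightarrow> bool" where
  "C1_with_gradient U \<phi> D\<phi> \<longleftrightarrow> (\<forall>x\<in>U. GDERIV \<phi> x :> D\<phi> x) \<and> continuous_on U D\<phi>"

definition viscosity_subsolution ::
  "'a::real_inner set \<Rightarrow> ('a \<Rightarrow> real \<Rightarrow> 'a \<Rightarrow> real) \<Rightarrow> ('a \<Rightarrow> real) \<Rightarrow> bool" where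
  "viscosity_subsolution U F u \<longleftrightarrow>
     (\<forall>\<phi> D\<phi> x. C1_with_gradient U \<phi> D\<phi> \<longrightarrow> x \<in> U \<longrightarrow>
        (\<forall>\<^sub>F y in nhds x. u y - \<phi> y \<le> u x - \<phi> x) \<longrightarrow> F x (u x) (D\<phi> x) \<le> 0)"

definition viscosity_supersolution ::
  "'a::real_inner set \<Rightarrow> ('a \<Rightarrow> real \<Rightarrow> 'a \<Rightarrow> real) \<Rightarrow> ('a \<Rightarrow> real) \<Rightarrow> bool" where
  "viscosity_supersolution U F u \<longleftrightarrow>
     (\<forall>\<phi> D\<phi> x. C1_with_gradient U \<phi> D\<phi> \<longrightarrow> x \<in> U \<longrightarrow>
        (\<forall>\<^sub>F y in nhds x. u x - \<phi> x \<le> u y - \<phi> y) \<longrightarrow> F x (u x) (D\<phi> x) \<ge> 0)"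

definition viscosity_solution ::
  "'a::real_inner set \<Rightarrow> ('a \<Rightarrow> real \<Rightarrow> 'a \<Rightarrow> real) \<Rightarrow> ('a \<Rightarrow> real) \<Rightarrow> bool" where
  "viscosity_solution U F u \<longleftrightarrow>
     continuous_on U u \<and> viscosity_subsolution U F u \<and> viscosity_supersolution U F u"

end

theory Submission
  imports Defs
begin

text \<open>
The time constant \<open>m\<close> is a norm, except that it need not be symmetric, and the limiting Hamiltonian
is its dual norm, \<open>H p = sup {p \<bullet> x | m x \<le> 1}\<close>. The equation \<open>H (Dm) = 1\<close> is then the eikonal
equation of a norm: formally, \<open>m\<close> grows along \<open>x\<close> at rate \<open>m x\<close> and along any other direction
\<open>z\<close> at rate at most \<open>m z\<close>, so its gradient lies on the dual unit sphere. The viscosity version of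
this remark is \<open>viscosity_solution_dual_norm\<close>.

The norm properties of \<open>m\<close> come from passage times. Since the weights lie between \<open>a > 0\<close> and \<open>b\<close>,
passage times are comparable to distances and Lipschitz in both endpoints, which gives positivity
and continuity of \<open>m\<close>; the triangle inequality for passage times gives subadditivity.

The duality comes from the control problem behind \<open>H\<close>: the value \<open>\<Sum> p \<bullet> (v\<^sub>i\<^sub>+\<^sub>1 - v\<^sub>i)\<close> of a path
depends only on its endpoints, so up to time \<open>t\<close> one maximizes \<open>- p \<bullet> y\<close> over the points \<open>y\<close>
with passage time at most \<open>t\<close> from the origin. After rescaling, this reachable set looks like
\<open>{y. m (- y) \<le> 1}\<close>. The two inequalities needed are \<open>inner_le_hamiltonian_times_time_constant\<close>,
where a nearly optimal path is used as a competitor, and \<open>hamiltonian_le_1\<close>, which uses a finite net of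
directions.

Both subadditivity and duality need passage times between points other than \<open>[n x]\<close> and the origin,
whereas the definition of \<open>m\<close> only provides almost sure limits for these. Passage times between
translated points have the same law, but the translations grow with \<open>n\<close>, so almost sure convergence
is lost. Convergence in probability is kept, and it suffices: events whose probabilities tend to
\<open>1\<close> occur infinitely often almost surely, and the limits to be compared exist already. This is
\<open>shifted_passage_times_frequently\<close>.
\<close>

section \<open>Nearest-neighbour paths\<close>

lemma latvec_add: "latvec (x + y) = latvec x + latvec y"
  and latvec_minus: "latvec (- x) = - latvec x"
  and latvec_diff: "latvec (x - y) = latvec x - latvec y"
  and latvec_zero: "latvec 0 = 0"
  by (simp_all add: latvec_def vec_eq_iff)

lemma norm_latvec_direction:
  assumes "\<alpha> \<in> directions"
  shows "norm (latvec \<alpha>) = 1"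
proof -
  have ax: "latvec (axis i 1) = axis i 1" for i :: 'a
    by (simp add: latvec_def axis_def vec_eq_iff)
  show ?thesis
    using assms by (auto simp: directions_def latvec_minus ax norm_axis_1)
qed

lemma nn_path_singleton: "nn_path [x]"
  by (simp add: nn_path_def)

lemma nn_path_Cons: "nn_path (x # y # \<gamma>) \<longleftrightarrow> y - x \<in> directions \<and> nn_path (y # \<gamma>)"
  unfolding nn_path_def by (auto simp: nth_Cons split: nat.splits)

lemma path_weight_singleton: "path_weight \<tau> \<omega> [x] = 0"
  by (simp add: path_weight_def)

lemma path_weight_Cons:
  "path_weight \<tau> \<omega> (x # y # \<gamma>) = \<tau> x (y - x) \<omega> + path_weight \<tau> \<omega> (y # \<gamma>)"
  by (simp add: path_weight_def sum.lessThan_Suc_shift del: sum.lessThan_Suc)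

lemma path_value_telescope:
  "nn_path \<gamma> \<Longrightarrow> path_value p \<gamma> = p \<bullet> (latvec (last \<gamma>) - latvec (hd \<gamma>))"
proof (induction \<gamma> rule: induct_list012)
  case (3 x y \<gamma>)
  have "path_value p (x # y # \<gamma>) = p \<bullet> latvec (y - x) + path_value p (y # \<gamma>)"
    by (simp add: path_value_def sum.lessThan_Suc_shift del: sum.lessThan_Suc)
  with 3 show ?case
    by (simp add: nn_path_Cons latvec_diff inner_diff_right)
qed (auto simp: nn_path_def path_value_def)

lemma nn_path_append:
  assumes "nn_path \<gamma>" "nn_path \<eta>" "last \<gamma> = hd \<eta>"
  shows "nn_path (\<gamma> @ tl \<eta>)" "hd (\<gamma> @ tl \<eta>) = hd \<gamma>" "last (\<gamma> @ tl \<eta>) = last \<eta>"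
    "path_weight \<tau> \<omega> (\<gamma> @ tl \<eta>) = path_weight \<tau> \<omega> \<gamma> + path_weight \<tau> \<omega> \<eta>"
proof -
  have ne: "\<gamma> \<noteq> []" "\<eta> \<noteq> []"
    using assms by (auto simp: nn_path_def)
  show "hd (\<gamma> @ tl \<eta>) = hd \<gamma>"
    using ne by simp
  show "last (\<gamma> @ tl \<eta>) = last \<eta>"
    using ne assms(3) by (cases \<eta>) (auto simp: last_append)
  have "nn_path (\<gamma> @ tl \<eta>) \<and>
    path_weight \<tau> \<omega> (\<gamma> @ tl \<eta>) = path_weight \<tau> \<omega> \<gamma> + path_weight \<tau> \<omega> \<eta>"
    using assms
  proof (induction \<gamma> rule: induct_list012)
    case 1
    then show ?case by (simp add: nn_path_def)
  next
    case (2 x)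
    then show ?case using ne by (cases \<eta>) (auto simp: path_weight_singleton)
  next
    case (3 x y \<gamma>)
    then show ?case by (simp add: nn_path_Cons path_weight_Cons)
  qed
  then show "nn_path (\<gamma> @ tl \<eta>)"
    "path_weight \<tau> \<omega> (\<gamma> @ tl \<eta>) = path_weight \<tau> \<omega> \<gamma> + path_weight \<tau> \<omega> \<eta>"
    by auto
qed

text \<open>Monotone lattice paths: correct one coordinate at a time. Their length is the \<open>\<ell>\<^sup>1\<close>
distance of the endpoints, so an environment bounded above makes passage times Lipschitz.\<close>

lemma nn_path_connects:
  fixes x y :: "int ^ 'd"
  obtains \<gamma> where "nn_path \<gamma>" "hd \<gamma> = x" "last \<gamma> = y"
    "int (length \<gamma> - 1) = (\<Sum>i\<in>UNIV. \<bar>y $ i - x $ i\<bar>)"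
proof -
  have "\<exists>\<gamma>. nn_path \<gamma> \<and> hd \<gamma> = x \<and> last \<gamma> = y \<and> int (length \<gamma> - 1) = int n"
    if "(\<Sum>i\<in>UNIV. \<bar>y $ i - x $ i\<bar>) = int n" for n
    using that
  proof (induction n arbitrary: x)
    case 0
    then have "x = y"
      by (simp add: sum_nonneg_eq_0_iff vec_eq_iff)
    then show ?case
      by (intro exI[of _ "[x]"]) (simp add: nn_path_singleton)
  next
    case (Suc n)
    have "\<exists>i. y $ i \<noteq> x $ i"
    proof (rule ccontr)
      assume "\<not> ?thesis"
      then have "(\<Sum>i\<in>UNIV. \<bar>y $ i - x $ i\<bar>) = 0" by simp
      with Suc.prems show False by simp
    qed
    then obtain i where i: "y $ i \<noteq> x $ i" by blast
    define s where "s = sgn (y $ i - x $ i)"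
    define \<alpha> :: "int ^ 'd" where "\<alpha> = axis i s"
    have s: "s = 1 \<or> s = - 1"
      using i by (auto simp: s_def sgn_if)
    then have \<alpha>: "\<alpha> \<in> directions"
    proof
      assume "s = - 1"
      then have "\<alpha> = - axis i 1"
        by (simp add: \<alpha>_def axis_def vec_eq_iff)
      then show ?thesis by (simp add: directions_def)
    qed (simp add: \<alpha>_def directions_def)
    have step: "\<bar>y $ j - (x + \<alpha>) $ j\<bar> = \<bar>y $ j - x $ j\<bar> - (if j = i then 1 else 0)" for j
      using i by (auto simp: \<alpha>_def axis_def s_def sgn_if)
    have "(\<Sum>j\<in>UNIV. \<bar>y $ j - (x + \<alpha>) $ j\<bar>) = int n"
      unfolding step using Suc.prems by (simp add: sum_subtractf)
    from Suc.IH[OF this] obtain \<gamma> where \<gamma>: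
      "nn_path \<gamma>" "hd \<gamma> = x + \<alpha>" "last \<gamma> = y" "length \<gamma> - 1 = n"
      by auto
    then obtain \<eta> where \<eta>: "\<gamma> = (x + \<alpha>) # \<eta>"
      by (cases \<gamma>) (auto simp: nn_path_def)
    show ?case
      using \<gamma> \<alpha> by (intro exI[of _ "x # \<gamma>"]) (auto simp: \<eta> nn_path_Cons)
  qed
  from this[of "nat (\<Sum>i\<in>UNIV. \<bar>y $ i - x $ i\<bar>)"] that show ?thesis
    by (auto simp: sum_nonneg)
qed

lemma latvec_displacement_le_length:
  "nn_path \<gamma> \<Longrightarrow> norm (latvec (last \<gamma>) - latvec (hd \<gamma>)) \<le> real (length \<gamma> - 1)"
proof (induction \<gamma> rule: induct_list012)
  case (3 x y \<gamma>)
  have "norm (latvec (last (y # \<gamma>)) - latvec x)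
      \<le> norm (latvec (last (y # \<gamma>)) - latvec y) + norm (latvec (y - x))"
    unfolding latvec_diff by (rule order_trans[OF _ norm_triangle_ineq]) simp
  with 3 show ?case
    by (simp add: nn_path_Cons norm_latvec_direction)
qed (auto simp: nn_path_def)

section \<open>Passage times in a bounded environment\<close>

definition bounded_weights ::
  "real \<Rightarrow> real \<Rightarrow> (int ^ 'd \<Rightarrow> int ^ 'd \<Rightarrow> 'w \<Rightarrow> real) \<Rightarrow> 'w \<Rightarrow> bool" where
  "bounded_weights a b \<tau> \<omega> \<longleftrightarrow> (\<forall>x. \<forall>\<alpha>\<in>directions. a \<le> \<tau> x \<alpha> \<omega> \<and> \<tau> x \<alpha> \<omega> \<le> b)"

lemma path_weight_length_bounds:
  assumes "bounded_weights a b \<tau> \<omega>"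
  shows "nn_path \<gamma> \<Longrightarrow> a * real (length \<gamma> - 1) \<le> path_weight \<tau> \<omega> \<gamma>
    \<and> path_weight \<tau> \<omega> \<gamma> \<le> b * real (length \<gamma> - 1)"
proof (induction \<gamma> rule: induct_list012)
  case (3 x y \<gamma>)
  then have "a \<le> \<tau> x (y - x) \<omega> \<and> \<tau> x (y - x) \<omega> \<le> b"
    using assms by (auto simp: bounded_weights_def nn_path_Cons)
  with 3 show ?case
    by (auto simp: nn_path_Cons path_weight_Cons algebra_simps)
qed (auto simp: nn_path_def path_weight_def)

locale bounded_environment =
  fixes a b :: real
    and \<tau> :: "int ^ 'd::finite \<Rightarrow> int ^ 'd \<Rightarrow> 'w \<Rightarrow> real"
    and \<omega> :: 'w
  assumes bounded: "bounded_weights a b \<tau> \<omega>"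
    and a_pos: "0 < a"
begin

abbreviation "T \<equiv> passage_time \<tau> \<omega>"
abbreviation "W \<equiv> path_weight \<tau> \<omega>"

lemma b_pos: "0 < b"
proof -
  have "axis undefined 1 \<in> (directions :: (int ^ 'd) set)"
    by (auto simp: directions_def)
  then have "a \<le> b"
    using bounded by (force simp: bounded_weights_def)
  with a_pos show ?thesis by simp
qed

lemma displacement_le_weight:
  assumes "nn_path \<gamma>"
  shows "a * norm (latvec (last \<gamma>) - latvec (hd \<gamma>)) \<le> W \<gamma>"
  using path_weight_length_bounds[OF bounded assms] latvec_displacement_le_length[OF assms] a_pos
  by (meson mult_left_mono less_imp_le order_trans)

lemma weight_nonneg: "nn_path \<gamma> \<Longrightarrow> 0 \<le> W \<gamma>"
  using displacement_le_weight[of \<gamma>] a_pos by (smt (verit) mult_nonneg_nonneg norm_ge_zero)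

lemma path_weights_bdd_below:
  "bdd_below {W \<gamma> |\<gamma>. nn_path \<gamma> \<and> hd \<gamma> = x \<and> last \<gamma> = y}"
  by (rule bdd_belowI[of _ 0]) (auto simp: weight_nonneg)

lemma path_weights_nonempty: "{W \<gamma> |\<gamma>. nn_path \<gamma> \<and> hd \<gamma> = x \<and> last \<gamma> = y} \<noteq> {}"
  by (rule nn_path_connects[of x y]) blast

lemma passage_time_le_weight: "nn_path \<gamma> \<Longrightarrow> T (hd \<gamma>) (last \<gamma>) \<le> W \<gamma>"
  unfolding passage_time_def by (rule cInf_lower[OF _ path_weights_bdd_below]) blast

text \<open>Replacing the infimum by a strict inequality turns statements on passage times into statements on
single paths. It also exhibits a sublevel set of the passage time as a countable union of events.\<close>

lemma passage_time_less_iff: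
  "T x y < c \<longleftrightarrow> (\<exists>\<gamma>. nn_path \<gamma> \<and> hd \<gamma> = x \<and> last \<gamma> = y \<and> W \<gamma> < c)"
  unfolding passage_time_def
  by (subst cInf_less_iff[OF path_weights_nonempty path_weights_bdd_below]) blast

lemma displacement_le_passage_time: "a * norm (latvec y - latvec x) \<le> T x y"
proof (rule ccontr)
  assume "\<not> ?thesis"
  then obtain \<gamma> where "nn_path \<gamma>" "hd \<gamma> = x" "last \<gamma> = y"
    "W \<gamma> < a * norm (latvec y - latvec x)"
    using passage_time_less_iff[of x y] by (auto simp: not_le)
  with displacement_le_weight[of \<gamma>] show False by auto
qed

lemma passage_time_triangle: "T x z \<le> T x y + T y z"
proof (rule field_le_epsilon)
  fix e :: real assume "0 < e"
  then have "T x y < T x y + e / 2" "T y z < T y z + e / 2"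
    by auto
  then obtain \<gamma> \<eta> where
    *: "nn_path \<gamma>" "hd \<gamma> = x" "last \<gamma> = y" "W \<gamma> < T x y + e / 2"
      "nn_path \<eta>" "hd \<eta> = y" "last \<eta> = z" "W \<eta> < T y z + e / 2"
    unfolding passage_time_less_iff by blast
  then have "T x z \<le> W (\<gamma> @ tl \<eta>)"
    using passage_time_le_weight[of "\<gamma> @ tl \<eta>"] nn_path_append(1-3)[of \<gamma> \<eta>] by auto
  also have "\<dots> = W \<gamma> + W \<eta>"
    using * by (intro nn_path_append(4)) auto
  finally show "T x z \<le> T x y + T y z + e"
    using * by auto
qed

lemma passage_time_le_displacement:
  "T x y \<le> b * real CARD('d) * norm (latvec x - latvec y)"
proof -
  obtain \<gamma> where \<gamma>: "nn_path \<gamma>" "hd \<gamma> = x" "last \<gamma> = y"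
    "int (length \<gamma> - 1) = (\<Sum>i\<in>UNIV. \<bar>y $ i - x $ i\<bar>)"
    by (rule nn_path_connects)
  have "real (length \<gamma> - 1) = real_of_int (int (length \<gamma> - 1))"
    by simp
  also have "\<dots> = (\<Sum>i\<in>UNIV. \<bar>(latvec x - latvec y) $ i\<bar>)"
    unfolding \<gamma>(4) by (simp add: latvec_def abs_minus_commute)
  also have "\<dots> \<le> real CARD('d) * norm (latvec x - latvec y)"
    by (rule sum_bounded_above) (rule component_le_norm_cart)
  finally have "b * real (length \<gamma> - 1) \<le> b * (real CARD('d) * norm (latvec x - latvec y))"
    using b_pos by (intro mult_left_mono) auto
  with \<gamma> passage_time_le_weight[of \<gamma>] path_weight_length_bounds[OF bounded, of \<gamma>]
  show ?thesis by (simp add: mult.assoc)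
qed

text \<open>In the directed setting \<open>T x y\<close> and \<open>T y x\<close> differ, and both endpoints have to be treated. The
constant depends on the environment only through its upper bound, so these estimates survive the
rescaling by \<open>1 / n\<close> and pass to the limit.\<close>

lemma passage_time_lipschitz:
  shows "T x z - T y z \<le> b * real CARD('d) * norm (latvec x - latvec y)"
    and "T z x - T z y \<le> b * real CARD('d) * norm (latvec x - latvec y)"
  using passage_time_triangle[of x z y] passage_time_le_displacement[of x y]
    passage_time_triangle[of z x y] passage_time_le_displacement[of y x]
  by (auto simp: norm_minus_commute)

end

text \<open>Rounding each coordinate down gives a competitor within \<open>\<ell>\<^sup>1\<close> distance \<open>CARD('d)\<close>. The bound does
not depend on \<open>y\<close>, which makes rounding errors vanish after division by \<open>n\<close>.\<close>

lemma closest_lattice_point_dist: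
  fixes r :: "real ^ 'd \<Rightarrow> int ^ 'd"
  assumes "closest_lattice_point r"
  shows "norm (latvec (r y) - y) \<le> real CARD('d)"
proof -
  define z :: "int ^ 'd" where "z = (\<chi> i. \<lfloor>y $ i\<rfloor>)"
  have "norm (latvec (r y) - y) \<le> dist y (latvec z)"
    using assms by (simp add: closest_lattice_point_def dist_norm norm_minus_commute)
  also have "\<dots> \<le> (\<Sum>i\<in>UNIV. \<bar>(y - latvec z) $ i\<bar>)"
    unfolding dist_norm by (rule norm_le_l1_cart)
  also have "\<dots> \<le> (\<Sum>i\<in>(UNIV :: 'd set). 1)"
    by (intro sum_mono) (simp add: z_def latvec_def, linarith)
  finally show ?thesis by simp
qed

section \<open>Viscosity solutions from dual norms\<close>

lemma GDERIV_directional: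
  assumes "GDERIV \<phi> x :> p"
  shows "((\<lambda>s. (\<phi> (x + s *\<^sub>R v) - \<phi> x) / s) \<longlongrightarrow> p \<bullet> v) (at_right 0)"
proof -
  have "(\<phi> has_derivative (\<lambda>h. h \<bullet> p)) (at (x + 0 *\<^sub>R v))"
    using assms by (simp add: gderiv_def)
  moreover have "((\<lambda>s. x + s *\<^sub>R v) has_derivative (\<lambda>s. s *\<^sub>R v)) (at (0 :: real))"
    by (auto intro!: derivative_eq_intros)
  ultimately have "((\<lambda>s. \<phi> (x + s *\<^sub>R v)) has_derivative (\<lambda>s. (s *\<^sub>R v) \<bullet> p)) (at (0 :: real))"
    by (rule has_derivative_compose[rotated])
  also have "(\<lambda>s. (s *\<^sub>R v) \<bullet> p) = (*) (p \<bullet> v)"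
    by (auto simp: inner_commute)
  finally have "((\<lambda>s. \<phi> (x + s *\<^sub>R v)) has_field_derivative p \<bullet> v) (at 0)"
    by (simp add: has_field_derivative_def)
  then have "(\<lambda>s. (\<phi> (x + s *\<^sub>R v) - \<phi> x) / s) \<midarrow>0\<rightarrow> p \<bullet> v"
    by (simp add: DERIV_def)
  then show ?thesis
    by (rule tendsto_mono[OF at_le, rotated]) simp
qed

lemma GDERIV_directional_le:
  assumes "GDERIV \<phi> x :> p" "\<forall>\<^sub>F s in at_right 0. \<phi> (x + s *\<^sub>R v) - \<phi> x \<le> s * c"
  shows "p \<bullet> v \<le> c"
proof (rule tendsto_upperbound[OF GDERIV_directional[OF assms(1)]])
  show "\<forall>\<^sub>F s in at_right 0. (\<phi> (x + s *\<^sub>R v) - \<phi> x) / s \<le> c"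
    using assms(2) eventually_at_right_less[of 0]
    by eventually_elim (simp add: divide_le_eq mult.commute)
qed simp

lemma GDERIV_directional_ge:
  assumes "GDERIV \<phi> x :> p" "\<forall>\<^sub>F s in at_right 0. s * c \<le> \<phi> (x + s *\<^sub>R v) - \<phi> x"
  shows "c \<le> p \<bullet> v"
proof -
  have "\<forall>\<^sub>F s in at_right 0. - \<phi> (x + s *\<^sub>R v) - - \<phi> x \<le> s * - c"
    using assms(2) by eventually_elim simp
  from GDERIV_directional_le[OF GDERIV_minus[OF assms(1)] this] show ?thesis
    by simp
qed

lemma eventually_along_ray:
  fixes x v :: "'a::real_inner"
  assumes "\<forall>\<^sub>F y in nhds x. Q y"
  shows "\<forall>\<^sub>F s in at_right 0. Q (x + s *\<^sub>R v)"
proof -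
  have "((\<lambda>s. x + s *\<^sub>R v) \<longlongrightarrow> x + 0 *\<^sub>R v) (at_right 0)"
    by (intro tendsto_intros)
  then show ?thesis
    using assms by (simp add: filterlim_iff)
qed

text \<open>The eikonal equation of a possibly asymmetric norm. A test function that touches \<open>m\<close> from above at
\<open>x\<close> decreases along \<open>- z\<close> at rate at most \<open>m z\<close>, because subadditivity gives
\<open>m (x - s z) \<ge> m x - s m z\<close>; hence its gradient lies in the dual unit ball. A test function that
touches \<open>m\<close> from below at \<open>x\<close> is compared with \<open>m\<close> on the segment from \<open>x\<close> towards the origin,
where \<open>m\<close> is linear; hence its gradient \<open>p\<close> satisfies \<open>p \<bullet> x \<ge> m x\<close>, so its dual norm is at
least \<open>1\<close>. The hypotheses on \<open>H\<close> follow from the identity \<open>H p = sup {p \<bullet> x | m x \<le> 1}\<close>.\<close>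

lemma viscosity_solution_dual_norm:
  fixes m H :: "'a::real_inner \<Rightarrow> real"
  assumes cont: "continuous_on UNIV m"
    and subadditive: "\<And>x y. m (x + y) \<le> m x + m y"
    and homogeneous: "\<And>s x. 0 < s \<Longrightarrow> m (s *\<^sub>R x) = s * m x"
    and positive: "\<And>x. x \<noteq> 0 \<Longrightarrow> 0 < m x"
    and dual_ge: "\<And>p x. p \<bullet> x \<le> H p * m x"
    and dual_le: "\<And>p. (\<And>x. p \<bullet> x \<le> m x) \<Longrightarrow> H p \<le> 1"
  shows "viscosity_solution (- {0}) (\<lambda>x u p. H p - 1) m"
  unfolding viscosity_solution_def
proof (intro conjI)
  show "continuous_on (- {0}) m"
    using cont continuous_on_subset by blast
  show "viscosity_subsolution (- {0}) (\<lambda>x u p. H p - 1) m"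
    unfolding viscosity_subsolution_def
  proof (intro allI impI)
    fix \<phi> D\<phi> and x :: 'a
    assume C1: "C1_with_gradient (- {0}) \<phi> D\<phi>" and x: "x \<in> - {0}"
      and touch: "\<forall>\<^sub>F y in nhds x. m y - \<phi> y \<le> m x - \<phi> x"
    from C1 x have grad: "GDERIV \<phi> x :> D\<phi> x"
      by (simp add: C1_with_gradient_def)
    have "D\<phi> x \<bullet> z \<le> m z" for z
    proof -
      have "\<forall>\<^sub>F s in at_right 0. s * - m z \<le> \<phi> (x + s *\<^sub>R - z) - \<phi> x"
        using eventually_along_ray[OF touch, of "- z"] eventually_at_right_less[of 0]
      proof eventually_elim
        case (elim s)
        have "m x \<le> m (x + s *\<^sub>R - z) + m (s *\<^sub>R z)"
          using subadditive[of "x + s *\<^sub>R - z" "s *\<^sub>R z"] by simp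
        with elim show ?case
          by (simp add: homogeneous)
      qed
      from GDERIV_directional_ge[OF grad this] show ?thesis
        by simp
    qed
    then show "H (D\<phi> x) - 1 \<le> 0"
      using dual_le by simp
  qed
  show "viscosity_supersolution (- {0}) (\<lambda>x u p. H p - 1) m"
    unfolding viscosity_supersolution_def
  proof (intro allI impI)
    fix \<phi> D\<phi> and x :: 'a
    assume C1: "C1_with_gradient (- {0}) \<phi> D\<phi>" and x: "x \<in> - {0}"
      and touch: "\<forall>\<^sub>F y in nhds x. m x - \<phi> x \<le> m y - \<phi> y"
    from C1 x have grad: "GDERIV \<phi> x :> D\<phi> x"
      by (simp add: C1_with_gradient_def)
    have "\<forall>\<^sub>F s in at_right (0 :: real). s < 1"
      by (rule eventually_at_rightI[of 0 1]) auto
    then have "\<forall>\<^sub>F s in at_right 0. \<phi> (x + s *\<^sub>R - x) - \<phi> x \<le> s * - m x"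
      using eventually_along_ray[OF touch, of "- x"]
    proof eventually_elim
      case (elim s)
      have "m (x + s *\<^sub>R - x) = (1 - s) * m x"
        using homogeneous[of "1 - s" x] elim(1) by (simp add: algebra_simps)
      with elim(2) show ?case
        by (simp add: algebra_simps)
    qed
    from GDERIV_directional_le[OF grad this] have "m x \<le> D\<phi> x \<bullet> x"
      by simp
    also have "\<dots> \<le> H (D\<phi> x) * m x"
      by (rule dual_ge)
    finally show "0 \<le> H (D\<phi> x) - 1"
      using positive[of x] x by simp
  qed
qed

section \<open>Events of asymptotically full probability\<close>

text \<open>An inequality that holds for infinitely many indices is enough to compare two limits. The
probabilistic argument below provides no more than this.\<close>

lemma frequently_le_limit:
  fixes X Y :: "nat \<Rightarrow> real"
  assumes "X \<longlonglongrightarrow> L" "Y \<longlonglongrightarrow> K" "\<exists>\<^sub>F n in sequentially. Y n \<le> X n"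
  shows "K \<le> L"
proof (rule ccontr)
  assume "\<not> K \<le> L"
  then obtain c where "L < c" "c < K"
    using dense[of L K] by auto
  then have "\<forall>\<^sub>F n in sequentially. X n < c \<and> c < Y n"
    using assms(1,2) by (intro eventually_conj order_tendstoD)
  then have "\<forall>\<^sub>F n in sequentially. \<not> Y n \<le> X n"
    by eventually_elim auto
  with assms(3) show False
    by (simp add: frequently_def)
qed

context prob_space
begin

text \<open>This is the mode of convergence that survives a translation of the environment by an amount which
varies with \<open>n\<close>: the translated events keep their probabilities, whereas almost sure convergence
along moving translations can fail.\<close>

definition asymptotically_full :: "(nat \<Rightarrow> 'a \<Rightarrow> bool) \<Rightarrow> bool" where
  "asymptotically_full P \<longleftrightarrow>
     (\<forall>n. {\<omega> \<in> space M. P n \<omega>} \<in> events) \<and> (\<lambda>n. prob {\<omega> \<in> space M. P n \<omega>}) \<longlonglongrightarrow> 1"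

lemma asymptotically_full_eventually:
  assumes meas: "\<And>n. {\<omega> \<in> space M. P n \<omega>} \<in> events"
    and ev: "AE \<omega> in M. \<forall>\<^sub>F n in sequentially. P n \<omega>"
  shows "asymptotically_full P"
proof -
  define B where "B n = {\<omega> \<in> space M. \<forall>k\<ge>n. P k \<omega>}" for n
  have B: "B n \<in> events" for n
  proof -
    have "B n = (\<Inter>k\<in>{n..}. {\<omega> \<in> space M. P k \<omega>})"
      by (auto simp: B_def)
    then show ?thesis using meas by auto
  qed
  have "(\<lambda>n. prob (B n)) \<longlonglongrightarrow> prob (\<Union>n. B n)"
  proof (rule finite_Lim_measure_incseq)
    show "range B \<subseteq> events" using B by blast
    show "incseq B" by (force simp: incseq_def B_def)
  qed
  also have "prob (\<Union>n. B n) = 1"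
  proof (subst prob_eq_1)
    show "(\<Union>n. B n) \<in> events" using B by auto
    show "AE \<omega> in M. \<omega> \<in> (\<Union>n. B n)"
      using ev by (rule AE_mp) (auto simp: B_def eventually_sequentially)
  qed
  finally have "(\<lambda>n. prob {\<omega> \<in> space M. P n \<omega>}) \<longlonglongrightarrow> 1"
  proof (rule tendsto_sandwich[rotated 2])
    show "\<forall>\<^sub>F n in sequentially. prob (B n) \<le> prob {\<omega> \<in> space M. P n \<omega>}"
      using meas by (intro always_eventually allI finite_measure_mono) (auto simp: B_def)
  qed auto
  with meas show ?thesis
    by (simp add: asymptotically_full_def)
qed

lemma asymptotically_full_shift:
  assumes P: "asymptotically_full P"
    and S: "\<And>n. S n \<in> measurable M M" "\<And>n. distr M M (S n) = M"
  shows "asymptotically_full (\<lambda>n \<omega>. P n (S n \<omega>))"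
proof -
  have eq: "{\<omega> \<in> space M. P n (S n \<omega>)} = S n -` {\<omega> \<in> space M. P n \<omega>} \<inter> space M" for n
    using measurable_space[OF S(1)[of n]] by auto
  have ev: "{\<omega> \<in> space M. P n \<omega>} \<in> events" for n
    using P by (simp add: asymptotically_full_def)
  have "prob {\<omega> \<in> space M. P n (S n \<omega>)} = prob {\<omega> \<in> space M. P n \<omega>}" for n
    unfolding eq using measure_distr[OF S(1) ev, of n n] by (simp add: S(2))
  moreover have "{\<omega> \<in> space M. P n (S n \<omega>)} \<in> events" for n
    unfolding eq by (rule measurable_sets[OF S(1) ev])
  ultimately show ?thesis
    using P by (simp add: asymptotically_full_def)
qed

lemma asymptotically_full_conj:
  assumes "asymptotically_full P" "asymptotically_full Q"
  shows "asymptotically_full (\<lambda>n \<omega>. P n \<omega> \<and> Q n \<omega>)"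
proof -
  let ?P = "\<lambda>n. {\<omega> \<in> space M. P n \<omega>}" and ?Q = "\<lambda>n. {\<omega> \<in> space M. Q n \<omega>}"
  have ev: "?P n \<in> events" "?Q n \<in> events" for n
    using assms by (auto simp: asymptotically_full_def)
  have eq: "{\<omega> \<in> space M. P n \<omega> \<and> Q n \<omega>} = ?P n \<inter> ?Q n" for n
    by auto
  have low: "prob (?P n) + prob (?Q n) - 1 \<le> prob (?P n \<inter> ?Q n)" for n
  proof -
    have "prob (space M - ?P n \<inter> ?Q n) \<le> prob (space M - ?P n) + prob (space M - ?Q n)"
      using ev by (intro order_trans[OF finite_measure_mono measure_Un_le]) auto
    with ev show ?thesis by (simp add: prob_compl)
  qed
  have lim: "(\<lambda>n. prob (?P n) + prob (?Q n) - 1) \<longlonglongrightarrow> 1 + 1 - 1"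
    using assms unfolding asymptotically_full_def by (intro tendsto_intros) blast+
  have "(\<lambda>n. prob (?P n \<inter> ?Q n)) \<longlonglongrightarrow> 1"
  proof (rule tendsto_sandwich[OF always_eventually always_eventually])
    show "(\<lambda>n. prob (?P n) + prob (?Q n) - 1) \<longlonglongrightarrow> 1" using lim by simp
    show "(\<lambda>n. 1 :: real) \<longlonglongrightarrow> 1" by (rule tendsto_const)
  qed (use low prob_le_1 in blast)+
  moreover have "?P n \<inter> ?Q n \<in> events" for n
    using ev by (rule sets.Int)
  ultimately show ?thesis
    unfolding asymptotically_full_def eq by blast
qed

lemma asymptotically_full_finite_ball:
  assumes "finite S" "\<And>z. z \<in> S \<Longrightarrow> asymptotically_full (P z)"
  shows "asymptotically_full (\<lambda>n \<omega>. \<forall>z\<in>S. P z n \<omega>)"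
  using assms
proof (induction S)
  case empty
  then show ?case by (simp add: asymptotically_full_def prob_space)
next
  case (insert z S)
  then show ?case
    using asymptotically_full_conj[of "P z" "\<lambda>n \<omega>. \<forall>z\<in>S. P z n \<omega>"] by simp
qed

text \<open>Fatou's lemma for events: a limsup of events whose probabilities tend to \<open>1\<close> has probability \<open>1\<close>.
It returns from convergence in probability to statements about a single environment, which can then
be combined with almost sure limits.\<close>

lemma asymptotically_full_AE_frequently:
  assumes P: "asymptotically_full P"
  shows "AE \<omega> in M. \<exists>\<^sub>F n in sequentially. P n \<omega>"
proof -
  let ?P = "\<lambda>n. {\<omega> \<in> space M. P n \<omega>}"
  have ev: "?P n \<in> events" for n
    using P by (auto simp: asymptotically_full_def)
  have "AE \<omega> in M. \<exists>n\<ge>N. P n \<omega>" for N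
  proof -
    have un: "(\<Union>n\<in>{N..}. ?P n) \<in> events"
      using ev by auto
    have "prob (?P n) \<le> prob (\<Union>n\<in>{N..}. ?P n)" if "n \<ge> N" for n
      using that un by (intro finite_measure_mono) auto
    then have "1 \<le> prob (\<Union>n\<in>{N..}. ?P n)"
      using P by (intro LIMSEQ_le_const2[of "\<lambda>n. prob (?P n)"])
        (auto simp: asymptotically_full_def)
    then have "prob (\<Union>n\<in>{N..}. ?P n) = 1"
      using prob_le_1 by (intro antisym) auto
    then have "AE \<omega> in M. \<omega> \<in> (\<Union>n\<in>{N..}. ?P n)"
      using un by (simp add: prob_eq_1)
    then show ?thesis by (rule AE_mp) auto
  qed
  then have "AE \<omega> in M. \<forall>N. \<exists>n\<ge>N. P n \<omega>"
    by (simp add: AE_all_countable)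
  then show ?thesis
    by (simp add: frequently_sequentially)
qed

end

section \<open>Stationary weights with finite essential bounds\<close>

locale bounded_ergodic_weights = stationary_ergodic_weights M V \<tau>
  for M :: "'w measure" and V :: "int ^ 'd::finite \<Rightarrow> 'w \<Rightarrow> 'w"
    and \<tau> :: "int ^ 'd \<Rightarrow> int ^ 'd \<Rightarrow> 'w \<Rightarrow> real" +
  fixes a b :: real
  assumes essinf: "weight_essinf M \<tau> = ereal a"
    and esssup: "weight_esssup M \<tau> = ereal b"
    and a_pos: "0 < a"
begin

text \<open>All path estimates are carried out in environments whose weights obey the essential bounds on every
edge at once. They form an event of probability \<open>1\<close> that is preserved by the translations.\<close>

definition "good = {\<omega> \<in> space M. bounded_weights a b \<tau> \<omega>}"

lemma countable_directions: "countable (directions :: (int ^ 'd) set)"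
  by (rule countableI_type)

text \<open>A null set for the product with counting measure is null on each slice, here on each edge.\<close>

lemma AE_edge_measureD:
  fixes Q :: "(int ^ 'd) \<times> (int ^ 'd) \<times> 'w \<Rightarrow> bool"
  assumes "AE e in edge_measure M. Q e" "\<alpha> \<in> directions"
  shows "AE \<omega> in M. Q (x, \<alpha>, \<omega>)"
proof -
  let ?C = "count_space (UNIV :: (int ^ 'd) set)"
    and ?D = "count_space (directions :: (int ^ 'd) set)"
  interpret D: sigma_finite_measure ?D
    by (rule sigma_finite_measure_count_space_countable[OF countable_directions])
  interpret DM: pair_sigma_finite ?D M ..
  interpret C: sigma_finite_measure ?C
    by (rule sigma_finite_measure_count_space)
  interpret CDM: pair_sigma_finite ?C "?D \<Otimes>\<^sub>M M" ..
  have "AE x in ?C. AE q in ?D \<Otimes>\<^sub>M M. Q (x, q)"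
    using assms(1) unfolding edge_measure_def by (rule CDM.AE_pair)
  then have "AE q in ?D \<Otimes>\<^sub>M M. Q (x, q)"
    by (simp add: AE_count_space)
  then have "AE \<alpha> in ?D. AE \<omega> in M. Q (x, \<alpha>, \<omega>)"
    by (rule DM.AE_pair)
  with assms(2) show ?thesis by (simp add: AE_count_space)
qed

lemma good_event: "good \<in> events"
proof -
  have "good = (\<Inter>x. \<Inter>\<alpha>\<in>directions. {\<omega> \<in> space M. a \<le> \<tau> x \<alpha> \<omega> \<and> \<tau> x \<alpha> \<omega> \<le> b})"
    by (auto simp: good_def bounded_weights_def directions_def)
  moreover have "{\<omega> \<in> space M. a \<le> \<tau> x \<alpha> \<omega> \<and> \<tau> x \<alpha> \<omega> \<le> b} \<in> events"
    if "\<alpha> \<in> directions" for x \<alpha>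
    using \<tau>_measurable[OF that, of x] by measurable
  ultimately show ?thesis
    by (auto intro!: sets.countable_INT' simp: directions_def countable_directions)
qed

lemma AE_good: "AE \<omega> in M. \<omega> \<in> good"
proof -
  \<comment> \<open>The essential bounds hold almost everywhere on the space of edges and environments; there are
    only countably many edges, so the exceptional sets can be united.\<close>
  have "AE e in edge_measure M. (\<lambda>(x, \<alpha>, \<omega>). ereal (\<tau> x \<alpha> \<omega>)) e \<le> ereal b"
    using esssup_AE[of _ "edge_measure M"] esssup unfolding weight_esssup_def by metis
  then have up: "AE \<omega> in M. \<tau> x \<alpha> \<omega> \<le> b" if "\<alpha> \<in> directions" for x \<alpha>
    using AE_edge_measureD[OF _ that, of _ x] by fastforce
  have "esssup (edge_measure M) (\<lambda>(x, \<alpha>, \<omega>). - ereal (\<tau> x \<alpha> \<omega>)) = ereal (- a)"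
    using essinf unfolding weight_essinf_def by (metis ereal_uminus_uminus uminus_ereal.simps(1))
  then have "AE e in edge_measure M. (\<lambda>(x, \<alpha>, \<omega>). - ereal (\<tau> x \<alpha> \<omega>)) e \<le> ereal (- a)"
    using esssup_AE[of "(\<lambda>(x, \<alpha>, \<omega>). - ereal (\<tau> x \<alpha> \<omega>))" "edge_measure M"] by metis
  then have lo: "AE \<omega> in M. a \<le> \<tau> x \<alpha> \<omega>" if "\<alpha> \<in> directions" for x \<alpha>
    using AE_edge_measureD[OF _ that, of _ x] by fastforce
  have "AE \<omega> in M. \<forall>x. \<forall>\<alpha>\<in>directions. a \<le> \<tau> x \<alpha> \<omega> \<and> \<tau> x \<alpha> \<omega> \<le> b"
    using up lo by (auto simp: AE_all_countable AE_ball_countable[OF countable_directions])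
  then show ?thesis
    by (rule AE_mp) (auto simp: good_def bounded_weights_def)
qed

lemma good_environment: "\<omega> \<in> good \<Longrightarrow> bounded_environment a b \<tau> \<omega>"
  by unfold_locales (auto simp: good_def a_pos)

lemma good_shift: "\<omega> \<in> good \<Longrightarrow> V z \<omega> \<in> good"
  using measurable_space[OF V_measurable]
  by (auto simp: good_def bounded_weights_def simp flip: \<tau>_stationary)

lemma passage_time_shift:
  assumes "\<omega> \<in> space M"
  shows "passage_time \<tau> (V z \<omega>) x y = passage_time \<tau> \<omega> (x + z) (y + z)"
proof -
  let ?s = "map (\<lambda>v. v + z)"
  have W: "path_weight \<tau> (V z \<omega>) \<gamma> = path_weight \<tau> \<omega> (?s \<gamma>)" if "nn_path \<gamma>" for \<gamma>
    using that assms unfolding path_weight_def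
    by (intro sum.cong) (auto simp: nn_path_def \<tau>_stationary[symmetric])
  have nn: "nn_path (map (\<lambda>v. v + c) \<gamma>) \<longleftrightarrow> nn_path \<gamma>" for c and \<gamma> :: "(int ^ 'd) list"
    by (auto simp: nn_path_def)
  have ends: "hd (map (\<lambda>v. v + c) \<gamma>) = hd \<gamma> + c" "last (map (\<lambda>v. v + c) \<gamma>) = last \<gamma> + c"
    if "nn_path \<gamma>" for c and \<gamma> :: "(int ^ 'd) list"
    using that by (auto simp: nn_path_def hd_map last_map)
  have "{path_weight \<tau> (V z \<omega>) \<gamma> |\<gamma>. nn_path \<gamma> \<and> hd \<gamma> = x \<and> last \<gamma> = y}
      = {path_weight \<tau> \<omega> \<gamma> |\<gamma>. nn_path \<gamma> \<and> hd \<gamma> = x + z \<and> last \<gamma> = y + z}"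
    (is "?A = ?B")
  proof (intro equalityI subsetI)
    fix c assume "c \<in> ?A"
    then obtain \<gamma> where "nn_path \<gamma>" "hd \<gamma> = x" "last \<gamma> = y" "c = path_weight \<tau> (V z \<omega>) \<gamma>"
      by blast
    then show "c \<in> ?B"
      using W[of \<gamma>] nn[of z \<gamma>] ends[of \<gamma> z] by (intro CollectI exI[of _ "?s \<gamma>"]) auto
  next
    fix c assume "c \<in> ?B"
    then obtain \<gamma> where \<gamma>: "nn_path \<gamma>" "hd \<gamma> = x + z" "last \<gamma> = y + z" "c = path_weight \<tau> \<omega> \<gamma>"
      by blast
    let ?g = "map (\<lambda>v. v + - z) \<gamma>"
    have "?s ?g = \<gamma>" by (simp add: o_def)
    then show "c \<in> ?A"
      using \<gamma> W[of ?g] nn[of "- z" \<gamma>] ends[of \<gamma> "- z"]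
      by (intro CollectI exI[of _ "?g"]) (auto simp del: map_map)
  qed
  then show ?thesis
    by (simp add: passage_time_def)
qed

text \<open>The indicator matters: outside \<open>good\<close> the set of path weights may be unbounded below, and its
infimum is then an unspecified number.\<close>

lemma passage_time_measurable_on_good:
  "(\<lambda>\<omega>. indicator good \<omega> * passage_time \<tau> \<omega> x y) \<in> borel_measurable M"
proof -
  have "passage_time \<tau> \<omega> x y < c \<longleftrightarrow>
      (\<exists>\<gamma>. nn_path \<gamma> \<and> hd \<gamma> = x \<and> last \<gamma> = y \<and> path_weight \<tau> \<omega> \<gamma> < c)" if "\<omega> \<in> good" for \<omega> c
    using bounded_environment.passage_time_less_iff[OF good_environment[OF that]] .
  then have eq: "{\<omega> \<in> space (restrict_space M good). passage_time \<tau> \<omega> x y < c} =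
      good \<inter> (\<Union>\<gamma>\<in>{\<gamma>. nn_path \<gamma> \<and> hd \<gamma> = x \<and> last \<gamma> = y}. {\<omega> \<in> space M. path_weight \<tau> \<omega> \<gamma> < c})"
    for c
    by (auto simp: space_restrict_space good_def)
  have "{\<omega> \<in> space M. path_weight \<tau> \<omega> \<gamma> < c} \<in> events" if "nn_path \<gamma>" for \<gamma> c
  proof -
    have "(\<lambda>\<omega>. path_weight \<tau> \<omega> \<gamma>) \<in> borel_measurable M"
      unfolding path_weight_def using that
      by (intro borel_measurable_sum \<tau>_measurable) (auto simp: nn_path_def)
    then show ?thesis by measurable
  qed
  then have "{\<omega> \<in> space (restrict_space M good). passage_time \<tau> \<omega> x y < c} \<in> events" for c
    unfolding eq using good_event by (auto intro!: sets.Int sets.countable_UN' countableI_type)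
  then have "(\<lambda>\<omega>. passage_time \<tau> \<omega> x y) \<in> borel_measurable (restrict_space M good)"
    unfolding borel_measurable_iff_less
    using good_event by (auto simp: sets_restrict_space_iff space_restrict_space)
  then show ?thesis
    using good_event by (simp add: borel_measurable_restrict_space_iff)
qed

end

section \<open>The time constant\<close>

locale homogenized_weights = bounded_ergodic_weights M V \<tau> a b
  for M :: "'w measure" and V :: "int ^ 'd::finite \<Rightarrow> 'w \<Rightarrow> 'w"
    and \<tau> :: "int ^ 'd \<Rightarrow> int ^ 'd \<Rightarrow> 'w \<Rightarrow> real" and a b :: real +
  fixes r :: "real ^ 'd \<Rightarrow> int ^ 'd" and m :: "real ^ 'd \<Rightarrow> real"
  assumes closest: "closest_lattice_point r"
    and time_constant: "is_time_constant M \<tau> r m"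
begin

abbreviation "passage \<equiv> passage_time \<tau>"

text \<open>\<open>K\<close> bounds the rounding error of \<open>r\<close>, and \<open>D\<close> is the Lipschitz constant of passage times.\<close>

definition K :: real where "K = real CARD('d)"

definition D :: real where "D = b * K"

lemma AE_time_constant:
  "AE \<omega> in M. \<omega> \<in> good \<and> (\<lambda>n. passage \<omega> (r (real n *\<^sub>R x)) 0 / real n) \<longlonglongrightarrow> m x"
  using AE_good time_constant by (auto simp: is_time_constant_def)

lemma AE_ex: "AE \<omega> in M. P \<omega> \<Longrightarrow> \<exists>\<omega>. P \<omega>"
  by (rule eventually_happens') (simp_all add: ae_filter_eq_bot_iff emeasure_space_1)

lemma D_pos: "0 < D"
proof -
  obtain \<omega> where "\<omega> \<in> good"
    using AE_ex[OF AE_good] by blast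
  then interpret bounded_environment a b \<tau> \<omega>
    by (rule good_environment)
  show ?thesis
    using b_pos by (simp add: D_def K_def)
qed

lemma rounding: "norm (latvec (r y) - y) \<le> K"
  unfolding K_def by (rule closest_lattice_point_dist[OF closest])

lemma rounding_diff: "norm (latvec (r u) - latvec (r v)) \<le> norm (u - v) + 2 * K"
proof -
  have "latvec (r u) - latvec (r v) = (latvec (r u) - u) + (u - v) + (v - latvec (r v))"
    by simp
  also have "norm \<dots> \<le> norm (latvec (r u) - u) + norm (u - v) + norm (v - latvec (r v))"
    by (rule norm_triangle_le add_mono norm_triangle_ineq order_refl)+
  finally show ?thesis
    using rounding[of u] rounding[of v] by (simp add: norm_minus_commute)
qed

lemma passage_time_diff_le:
  assumes "\<omega> \<in> good" "norm (latvec x - latvec y) \<le> c"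
  shows "passage \<omega> x z - passage \<omega> y z \<le> D * c" "passage \<omega> z x - passage \<omega> z y \<le> D * c"
proof -
  interpret bounded_environment a b \<tau> \<omega>
    using assms(1) by (rule good_environment)
  have "D * norm (latvec x - latvec y) \<le> D * c"
    using assms(2) D_pos by (intro mult_left_mono) auto
  then show "passage \<omega> x z - passage \<omega> y z \<le> D * c" "passage \<omega> z x - passage \<omega> z y \<le> D * c"
    using passage_time_lipschitz(1)[of x z y] passage_time_lipschitz(2)[of z x y]
    by (auto simp: D_def K_def)
qed

lemma divide_by_n_le: "0 < n \<Longrightarrow> t \<le> real n * c + d \<Longrightarrow> t / real n \<le> c + d / real n"
  using divide_right_mono[of t "real n * c + d" "real n"] by (simp add: add_divide_distrib)

lemma divide_by_n_ge: "0 < n \<Longrightarrow> real n * c - d \<le> t \<Longrightarrow> c - d / real n \<le> t / real n"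
  using divide_right_mono[of "real n * c - d" t "real n"] by (simp add: diff_divide_distrib)

lemma time_constant_lipschitz: "m x - m y \<le> D * norm (x - y)"
proof -
  have "AE \<omega> in M. \<omega> \<in> good \<and> (\<lambda>n. passage \<omega> (r (real n *\<^sub>R x)) 0 / real n) \<longlonglongrightarrow> m x
      \<and> (\<lambda>n. passage \<omega> (r (real n *\<^sub>R y)) 0 / real n) \<longlonglongrightarrow> m y"
    using AE_time_constant[of x] AE_time_constant[of y] by auto
  then obtain \<omega> where \<omega>: "\<omega> \<in> good"
    "(\<lambda>n. passage \<omega> (r (real n *\<^sub>R x)) 0 / real n) \<longlonglongrightarrow> m x"
    "(\<lambda>n. passage \<omega> (r (real n *\<^sub>R y)) 0 / real n) \<longlonglongrightarrow> m y"
    using AE_ex by blast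
  have "m x - m y \<le> D * norm (x - y) + 0"
  proof (rule tendsto_le[OF _ _ tendsto_diff[OF \<omega>(2,3)]])
    show "(\<lambda>n. D * norm (x - y) + (2 * D * K) / real n) \<longlonglongrightarrow> D * norm (x - y) + 0"
      by (intro tendsto_add tendsto_const lim_const_over_n)
    show "\<forall>\<^sub>F n in sequentially.
        passage \<omega> (r (real n *\<^sub>R x)) 0 / real n - passage \<omega> (r (real n *\<^sub>R y)) 0 / real n
        \<le> D * norm (x - y) + (2 * D * K) / real n"
      using eventually_gt_at_top[of 0]
    proof eventually_elim
      case (elim n)
      have "norm (real n *\<^sub>R x - real n *\<^sub>R y) = real n * norm (x - y)"
        by (simp flip: scaleR_diff_right)
      then have "passage \<omega> (r (real n *\<^sub>R x)) 0 - passage \<omega> (r (real n *\<^sub>R y)) 0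
          \<le> D * (real n * norm (x - y) + 2 * K)"
        using passage_time_diff_le(1)[OF \<omega>(1) rounding_diff[of "real n *\<^sub>R x" "real n *\<^sub>R y"]]
        by simp
      with elim show ?case
        unfolding diff_divide_distrib[symmetric] by (intro divide_by_n_le) (simp_all add: algebra_simps)
    qed
  qed simp
  then show ?thesis by simp
qed

lemma time_constant_continuous: "continuous_on UNIV m"
proof -
  have "\<bar>m x - m y\<bar> \<le> D * norm (x - y)" for x y
    using time_constant_lipschitz[of x y] time_constant_lipschitz[of y x]
    by (simp add: norm_minus_commute)
  then have "D-lipschitz_on UNIV m"
    using D_pos by (intro lipschitz_onI) (auto simp: dist_norm)
  then show ?thesis
    by (rule lipschitz_on_continuous_on)
qed

lemma time_constant_zero: "m 0 = 0"
proof -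
  obtain \<omega> where "(\<lambda>n. passage \<omega> (r (real n *\<^sub>R 0)) 0 / real n) \<longlonglongrightarrow> m 0"
    using AE_ex[OF AE_time_constant[of 0]] by blast
  then have "(\<lambda>n. passage \<omega> (r 0) 0 / real n) \<longlonglongrightarrow> m 0"
    by simp
  then show ?thesis
    using lim_const_over_n LIMSEQ_unique by blast
qed

lemma time_constant_ge: "a * norm x \<le> m x"
proof -
  obtain \<omega> where \<omega>: "\<omega> \<in> good" "(\<lambda>n. passage \<omega> (r (real n *\<^sub>R x)) 0 / real n) \<longlonglongrightarrow> m x"
    using AE_ex[OF AE_time_constant[of x]] by blast
  interpret bounded_environment a b \<tau> \<omega>
    using \<omega>(1) by (rule good_environment)
  have "a * norm x - 0 \<le> m x"
  proof (rule tendsto_le[OF _ \<omega>(2)])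
    show "(\<lambda>n. a * norm x - (a * K) / real n) \<longlonglongrightarrow> a * norm x - 0"
      by (intro tendsto_diff tendsto_const lim_const_over_n)
    show "\<forall>\<^sub>F n in sequentially.
        a * norm x - (a * K) / real n \<le> passage \<omega> (r (real n *\<^sub>R x)) 0 / real n"
      using eventually_gt_at_top[of 0]
    proof eventually_elim
      case (elim n)
      have "real n * norm x = norm (real n *\<^sub>R x)"
        by simp
      also have "\<dots> \<le> norm (latvec (r (real n *\<^sub>R x))) + K"
        using rounding[of "real n *\<^sub>R x"] norm_triangle_ineq3 by (smt (verit, best))
      finally have "a * (real n * norm x - K) \<le> a * norm (latvec (r (real n *\<^sub>R x)))"
        using a_pos by (intro mult_left_mono) auto
      also have "\<dots> \<le> passage \<omega> (r (real n *\<^sub>R x)) 0"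
        using displacement_le_passage_time[of 0 "r (real n *\<^sub>R x)"] by (simp add: latvec_zero)
      finally show ?case
        using elim by (intro divide_by_n_ge) (simp_all add: algebra_simps)
    qed
  qed simp
  then show ?thesis by simp
qed

text \<open>For real \<open>s\<close> the numbers \<open>n s\<close> need not be integers. Replacing them by \<open>\<lfloor>n s\<rfloor>\<close> moves the starting
point by a bounded amount, after which the limit along \<open>n x\<close> can be used along a subsequence.\<close>

lemma time_constant_homogeneous:
  assumes s: "0 < s"
  shows "m (s *\<^sub>R x) = s * m x"
proof -
  have "AE \<omega> in M. \<omega> \<in> good \<and> (\<lambda>n. passage \<omega> (r (real n *\<^sub>R x)) 0 / real n) \<longlonglongrightarrow> m x
      \<and> (\<lambda>n. passage \<omega> (r (real n *\<^sub>R (s *\<^sub>R x))) 0 / real n) \<longlonglongrightarrow> m (s *\<^sub>R x)"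
    using AE_time_constant[of x] AE_time_constant[of "s *\<^sub>R x"] by auto
  then obtain \<omega> where \<omega>: "\<omega> \<in> good"
    "(\<lambda>n. passage \<omega> (r (real n *\<^sub>R x)) 0 / real n) \<longlonglongrightarrow> m x"
    "(\<lambda>n. passage \<omega> (r (real n *\<^sub>R (s *\<^sub>R x))) 0 / real n) \<longlonglongrightarrow> m (s *\<^sub>R x)"
    using AE_ex by blast
  define k where "k n = nat \<lfloor>real n * s\<rfloor>" for n
  have k: "real (k n) \<le> real n * s" "real n * s \<le> real (k n) + 1" for n
    using s by (simp_all add: k_def)
  have k_top: "filterlim k at_top sequentially"
    unfolding k_def
    by (intro filterlim_compose[OF filterlim_nat_sequentially]
        filterlim_compose[OF filterlim_floor_sequentially]
        filterlim_at_top_mult_tendsto_pos[OF tendsto_const s] filterlim_real_sequentially)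
  \<comment> \<open>The rescaled passage times along \<open>k\<close> are normalized by \<open>k n\<close>, not by \<open>n\<close>.\<close>
  have k_ratio: "(\<lambda>n. real (k n) / real n) \<longlonglongrightarrow> s"
  proof (rule tendsto_sandwich[OF _ _ _ tendsto_const])
    show "(\<lambda>n. s - 1 / real n) \<longlonglongrightarrow> s"
      using tendsto_diff[OF tendsto_const lim_const_over_n[of 1], of s] by simp
    show "\<forall>\<^sub>F n in sequentially. s - 1 / real n \<le> real (k n) / real n"
      using eventually_gt_at_top[of 0]
    proof eventually_elim
      case (elim n)
      then show ?case using k(2)[of n] by (intro divide_by_n_ge) auto
    qed
    show "\<forall>\<^sub>F n in sequentially. real (k n) / real n \<le> s"
      using eventually_gt_at_top[of 0]
    proof eventually_elim
      case (elim n)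
      then show ?case using k(1)[of n] by (simp add: field_simps)
    qed
  qed
  have lim: "(\<lambda>n. passage \<omega> (r (real (k n) *\<^sub>R x)) 0 / real (k n) * (real (k n) / real n)) \<longlonglongrightarrow> m x * s"
    by (intro tendsto_mult k_ratio filterlim_compose[OF \<omega>(2) k_top])
  have null: "(\<lambda>n. passage \<omega> (r (real n *\<^sub>R (s *\<^sub>R x))) 0 / real n
      - passage \<omega> (r (real (k n) *\<^sub>R x)) 0 / real (k n) * (real (k n) / real n)) \<longlonglongrightarrow> 0"
  proof (rule Lim_null_comparison)
    show "(\<lambda>n. D * (norm x + 2 * K) / real n) \<longlonglongrightarrow> 0"
      by (rule lim_const_over_n)
    have "\<forall>\<^sub>F n in sequentially. 0 < k n"
      by (rule eventually_compose_filterlim[OF eventually_gt_at_top k_top])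
    then show "\<forall>\<^sub>F n in sequentially. norm (passage \<omega> (r (real n *\<^sub>R (s *\<^sub>R x))) 0 / real n
        - passage \<omega> (r (real (k n) *\<^sub>R x)) 0 / real (k n) * (real (k n) / real n))
        \<le> D * (norm x + 2 * K) / real n"
      using eventually_gt_at_top[of 0]
    proof eventually_elim
      case (elim n)
      let ?u = "real n *\<^sub>R (s *\<^sub>R x)" and ?v = "real (k n) *\<^sub>R x"
      have "norm (?u - ?v) = \<bar>real n * s - real (k n)\<bar> * norm x"
        by (simp flip: scaleR_diff_left)
      also have "\<dots> \<le> 1 * norm x"
        using k[of n] by (intro mult_right_mono) auto
      finally have "norm (latvec (r ?u) - latvec (r ?v)) \<le> norm x + 2 * K"
        using rounding_diff[of ?u ?v] by simp
      then have "\<bar>passage \<omega> (r ?u) 0 - passage \<omega> (r ?v) 0\<bar> \<le> D * (norm x + 2 * K)"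
        using passage_time_diff_le(1)[OF \<omega>(1), of "r ?u" "r ?v" "norm x + 2 * K" 0]
          passage_time_diff_le(1)[OF \<omega>(1), of "r ?v" "r ?u" "norm x + 2 * K" 0]
        by (auto simp: norm_minus_commute abs_le_iff)
      then have "\<bar>passage \<omega> (r ?u) 0 - passage \<omega> (r ?v) 0\<bar> / real n \<le> D * (norm x + 2 * K) / real n"
        by (rule divide_right_mono) simp
      with elim show ?case
        by (simp add: diff_divide_distrib[symmetric])
    qed
  qed
  have "(\<lambda>n. passage \<omega> (r (real n *\<^sub>R (s *\<^sub>R x))) 0 / real n) \<longlonglongrightarrow> m x * s + 0"
    using tendsto_add[OF lim null] by simp
  then show ?thesis
    using LIMSEQ_unique[OF \<omega>(3)] by (simp add: mult.commute)
qed


text \<open>The time constant only describes passages into the origin. By stationarity a passage from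
\<open>[n x] + w\<close> to \<open>w\<close> has the law of the passage from \<open>[n x]\<close> to \<open>0\<close>, so it obeys the same limit in
probability, even when \<open>w\<close> moves with \<open>n\<close> and \<open>x\<close>. For finitely many \<open>x\<close> the limit is
approximated simultaneously, for infinitely many \<open>n\<close>, in almost every environment.\<close>

lemma shifted_passage_times_frequently:
  assumes S: "finite S" and e: "0 < e"
  shows "AE \<omega> in M. \<omega> \<in> good \<longrightarrow> (\<exists>\<^sub>F n in sequentially. \<forall>x\<in>S.
    \<bar>passage \<omega> (r (real n *\<^sub>R x) + w x n) (w x n) / real n - m x\<bar> < e)"
proof -
  let ?P = "\<lambda>x n \<omega>.
    \<bar>indicator good \<omega> * passage \<omega> (r (real n *\<^sub>R x)) 0 / real n - m x\<bar> < e"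
  have "asymptotically_full (?P x)" for x
  proof (rule asymptotically_full_eventually)
    fix n
    note [measurable] = passage_time_measurable_on_good[of "r (real n *\<^sub>R x)" 0]
    show "{\<omega> \<in> space M. ?P x n \<omega>} \<in> events"
      by measurable
  next
    show "AE \<omega> in M. \<forall>\<^sub>F n in sequentially. ?P x n \<omega>"
      using AE_time_constant[of x]
    proof (rule AE_mp, intro AE_I2 impI)
      fix \<omega>
      assume "\<omega> \<in> good \<and> (\<lambda>n. passage \<omega> (r (real n *\<^sub>R x)) 0 / real n) \<longlonglongrightarrow> m x"
      with e show "\<forall>\<^sub>F n in sequentially. ?P x n \<omega>"
        by (auto simp: tendsto_iff dist_real_def)
    qed
  qed
  then have "asymptotically_full (\<lambda>n \<omega>. ?P x n (V (w x n) \<omega>))" for x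
    by (rule asymptotically_full_shift[OF _ V_measurable V_preserving])
  then have "asymptotically_full (\<lambda>n \<omega>. \<forall>x\<in>S. ?P x n (V (w x n) \<omega>))"
    by (rule asymptotically_full_finite_ball[OF S])
  then have "AE \<omega> in M. \<exists>\<^sub>F n in sequentially. \<forall>x\<in>S. ?P x n (V (w x n) \<omega>)"
    by (rule asymptotically_full_AE_frequently)
  then show ?thesis
  proof (rule AE_mp, intro AE_I2 impI)
    fix \<omega> assume "\<omega> \<in> space M" "\<omega> \<in> good"
      and "\<exists>\<^sub>F n in sequentially. \<forall>x\<in>S. ?P x n (V (w x n) \<omega>)"
    then show "\<exists>\<^sub>F n in sequentially. \<forall>x\<in>S.
        \<bar>passage \<omega> (r (real n *\<^sub>R x) + w x n) (w x n) / real n - m x\<bar> < e"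
      by (simp add: passage_time_shift good_shift)
  qed
qed

text \<open>Translation by \<open>- [n x]\<close> turns the passages into the origin, which define \<open>m\<close>, into passages out of
the origin, which define the Hamiltonian. The displacement stays the same, so the target is
\<open>- [n x]\<close>.\<close>

lemma reversed_passage_times_frequently:
  assumes "finite S" "0 < e"
  shows "AE \<omega> in M. \<omega> \<in> good \<longrightarrow> (\<exists>\<^sub>F n in sequentially. \<forall>x\<in>S.
    \<bar>passage \<omega> 0 (- r (real n *\<^sub>R x)) / real n - m x\<bar> < e)"
  using shifted_passage_times_frequently[OF assms, of "\<lambda>x n. - r (real n *\<^sub>R x)"] by simp

text \<open>Travel from \<open>[n (x + y)]\<close> to the origin through \<open>[n x] + [n y]\<close> and \<open>[n y]\<close>: the first leg is
bounded by rounding errors, the last is governed by \<open>m y\<close>, and the middle one is a translate of a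
passage for \<open>x\<close> by the moving vector \<open>[n y]\<close>.\<close>

lemma time_constant_subadditive: "m (x + y) \<le> m x + m y"
proof (rule field_le_epsilon)
  fix e :: real assume e: "0 < e"
  let ?rx = "\<lambda>n. r (real n *\<^sub>R x)" and ?ry = "\<lambda>n. r (real n *\<^sub>R y)"
    and ?rxy = "\<lambda>n. r (real n *\<^sub>R (x + y))"
  have "AE \<omega> in M. \<omega> \<in> good \<and> (\<lambda>n. passage \<omega> (?ry n) 0 / real n) \<longlonglongrightarrow> m y
      \<and> (\<lambda>n. passage \<omega> (?rxy n) 0 / real n) \<longlonglongrightarrow> m (x + y)
      \<and> (\<exists>\<^sub>F n in sequentially. \<bar>passage \<omega> (?rx n + ?ry n) (?ry n) / real n - m x\<bar> < e)"
    using AE_time_constant[of y] AE_time_constant[of "x + y"]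
      shifted_passage_times_frequently[of "{x}" e "\<lambda>x. ?ry"] e by auto
  then obtain \<omega> where \<omega>: "\<omega> \<in> good" "(\<lambda>n. passage \<omega> (?ry n) 0 / real n) \<longlonglongrightarrow> m y"
    "(\<lambda>n. passage \<omega> (?rxy n) 0 / real n) \<longlonglongrightarrow> m (x + y)"
    and freq: "\<exists>\<^sub>F n in sequentially. \<bar>passage \<omega> (?rx n + ?ry n) (?ry n) / real n - m x\<bar> < e"
    using AE_ex by blast
  interpret bounded_environment a b \<tau> \<omega>
    using \<omega>(1) by (rule good_environment)
  have "m (x + y) \<le> (m x + e) + m y + 0"
  proof (rule frequently_le_limit[OF _ \<omega>(3)])
    show "(\<lambda>n. (m x + e) + passage \<omega> (?ry n) 0 / real n + D * (3 * K) / real n)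
        \<longlonglongrightarrow> (m x + e) + m y + 0"
      by (intro tendsto_add tendsto_const \<omega>(2) lim_const_over_n)
    have "\<exists>\<^sub>F n in sequentially.
        \<bar>passage \<omega> (?rx n + ?ry n) (?ry n) / real n - m x\<bar> < e \<and> 0 < n"
      by (rule frequently_eventually_frequently[OF freq eventually_gt_at_top])
    then show "\<exists>\<^sub>F n in sequentially. passage \<omega> (?rxy n) 0 / real n
        \<le> (m x + e) + passage \<omega> (?ry n) 0 / real n + D * (3 * K) / real n"
    proof (rule frequently_elim1)
      fix n assume n: "\<bar>passage \<omega> (?rx n + ?ry n) (?ry n) / real n - m x\<bar> < e \<and> 0 < n"
      let ?u = "real n *\<^sub>R x" and ?v = "real n *\<^sub>R y"
      have "latvec (?rxy n) - latvec (?rx n + ?ry n) =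
          (latvec (r (?u + ?v)) - (?u + ?v)) + (?u - latvec (r ?u)) + (?v - latvec (r ?v))"
        by (simp add: latvec_add scaleR_add_right)
      also have "norm \<dots> \<le> norm (latvec (r (?u + ?v)) - (?u + ?v))
          + norm (?u - latvec (r ?u)) + norm (?v - latvec (r ?v))"
        by (rule norm_triangle_le add_mono norm_triangle_ineq order_refl)+
      also have "\<dots> \<le> 3 * K"
        using rounding[of "?u + ?v"] rounding[of ?u] rounding[of ?v]
        by (simp add: norm_minus_commute)
      finally have "passage \<omega> (?rxy n) 0 \<le> passage \<omega> (?rx n + ?ry n) 0 + D * (3 * K)"
        using passage_time_diff_le(1)[OF \<omega>(1)] by (metis add.commute diff_le_eq)
      also have "passage \<omega> (?rx n + ?ry n) 0
          \<le> passage \<omega> (?rx n + ?ry n) (?ry n) + passage \<omega> (?ry n) 0"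
        by (rule passage_time_triangle)
      finally have "passage \<omega> (?rxy n) 0 / real n
          \<le> (passage \<omega> (?rx n + ?ry n) (?ry n) + passage \<omega> (?ry n) 0 + D * (3 * K)) / real n"
        by (intro divide_right_mono) auto
      with n show "passage \<omega> (?rxy n) 0 / real n
          \<le> (m x + e) + passage \<omega> (?ry n) 0 / real n + D * (3 * K) / real n"
        by (auto simp: add_divide_distrib abs_less_iff)
    qed
  qed
  then show "m (x + y) \<le> m x + m y + e"
    by simp
qed

section \<open>The limiting Hamiltonian as a dual norm\<close>

lemma endpoint_norm_le:
  assumes "\<omega> \<in> good" "nn_path \<gamma>" "hd \<gamma> = 0" "path_weight \<tau> \<omega> \<gamma> \<le> t"
  shows "norm (latvec (last \<gamma>)) \<le> t / a"
proof -
  interpret bounded_environment a b \<tau> \<omega>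
    using assms(1) by (rule good_environment)
  show ?thesis
    using displacement_le_weight[OF assms(2)] assms(3,4) a_pos
    by (simp add: latvec_zero pos_le_divide_eq mult.commute)
qed

lemma finite_time_value_le:
  assumes "\<omega> \<in> good" "nn_path \<gamma>" "hd \<gamma> = 0" "path_weight \<tau> \<omega> \<gamma> \<le> t"
  shows "finite_time_value \<tau> \<omega> p 0 t \<le> p \<bullet> latvec (last \<gamma>)"
  unfolding finite_time_value_def
proof (rule cInf_lower)
  show "p \<bullet> latvec (last \<gamma>) \<in> {path_value p \<gamma> |\<gamma>. nn_path \<gamma> \<and> hd \<gamma> = 0 \<and> path_weight \<tau> \<omega> \<gamma> \<le> t}"
    using assms by (auto simp: path_value_telescope latvec_zero intro!: exI[of _ \<gamma>])
  show "bdd_below {path_value p \<gamma> |\<gamma>. nn_path \<gamma> \<and> hd \<gamma> = 0 \<and> path_weight \<tau> \<omega> \<gamma> \<le> t}"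
  proof (rule bdd_belowI)
    fix v assume "v \<in> {path_value p \<gamma> |\<gamma>. nn_path \<gamma> \<and> hd \<gamma> = 0 \<and> path_weight \<tau> \<omega> \<gamma> \<le> t}"
    then obtain \<eta> where \<eta>: "nn_path \<eta>" "hd \<eta> = 0" "path_weight \<tau> \<omega> \<eta> \<le> t" "v = path_value p \<eta>"
      by blast
    have "\<bar>p \<bullet> latvec (last \<eta>)\<bar> \<le> norm p * norm (latvec (last \<eta>))"
      by (rule Cauchy_Schwarz_ineq2)
    also have "\<dots> \<le> norm p * (t / a)"
      using endpoint_norm_le[OF assms(1) \<eta>(1-3)] by (rule mult_left_mono) simp
    finally show "- (norm p * (t / a)) \<le> v"
      using \<eta> by (simp add: path_value_telescope latvec_zero)
  qed
qed

lemma finite_time_value_ge: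
  assumes "0 \<le> t" "\<And>\<gamma>. nn_path \<gamma> \<Longrightarrow> hd \<gamma> = 0 \<Longrightarrow> path_weight \<tau> \<omega> \<gamma> \<le> t \<Longrightarrow> c \<le> p \<bullet> latvec (last \<gamma>)"
  shows "c \<le> finite_time_value \<tau> \<omega> p 0 t"
  unfolding finite_time_value_def
proof (rule cInf_greatest)
  have "nn_path [0 :: int ^ 'd]" "path_weight \<tau> \<omega> [0] \<le> t"
    using assms(1) by (simp_all add: nn_path_singleton path_weight_singleton)
  then show "{path_value p \<gamma> |\<gamma>. nn_path \<gamma> \<and> hd \<gamma> = 0 \<and> path_weight \<tau> \<omega> \<gamma> \<le> t} \<noteq> {}"
    by (metis (mono_tags, lifting) empty_Collect_eq list.sel(1))
qed (use assms(2) in \<open>auto simp: path_value_telescope latvec_zero\<close>)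

context
  fixes H :: "real ^ 'd \<Rightarrow> real"
  assumes hamiltonian: "is_limiting_hamiltonian M \<tau> H"
begin

lemma AE_hamiltonian:
  assumes "finite S" "0 < e"
  shows "AE \<omega> in M. \<omega> \<in> good
    \<and> ((\<lambda>t. - (finite_time_value \<tau> \<omega> p 0 t / t)) \<longlongrightarrow> H p) at_top
    \<and> (\<exists>\<^sub>F n in sequentially. (\<forall>x\<in>S.
        \<bar>passage \<omega> 0 (- r (real n *\<^sub>R x)) / real n - m x\<bar> < e) \<and> 0 < n)"
proof -
  have "AE \<omega> in M. \<omega> \<in> good
    \<and> ((\<lambda>t. - (finite_time_value \<tau> \<omega> p 0 t / t)) \<longlongrightarrow> H p) at_top
    \<and> (\<exists>\<^sub>F n in sequentially. \<forall>x\<in>S. \<bar>passage \<omega> 0 (- r (real n *\<^sub>R x)) / real n - m x\<bar> < e)"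
    using AE_good hamiltonian reversed_passage_times_frequently[OF assms]
    unfolding is_limiting_hamiltonian_def by auto
  moreover have "\<exists>\<^sub>F n in sequentially. P n \<and> 0 < n" if "\<exists>\<^sub>F n in sequentially. P n"
    for P :: "nat \<Rightarrow> bool"
    by (rule frequently_eventually_frequently[OF that eventually_gt_at_top])
  ultimately show ?thesis
    by (elim eventually_mono conjE) (intro conjI)
qed

text \<open>A nearly optimal path from \<open>0\<close> to \<open>- [n x]\<close> takes time less than \<open>n (m x + e)\<close> and is therefore a
competitor in the control problem with that time horizon; its value is about \<open>- n (p \<bullet> x)\<close>.\<close>

lemma inner_le_hamiltonian_times_time_constant: "p \<bullet> x \<le> H p * m x"
proof -
  have *: "p \<bullet> x / (m x + e) \<le> H p" if e: "0 < e" for e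
  proof -
    define c where "c = m x + e"
    have "0 \<le> a * norm x"
      using a_pos by simp
    then have c: "0 < c"
      using time_constant_ge[of x] e by (simp add: c_def)
    obtain \<omega> where \<omega>: "\<omega> \<in> good"
      "((\<lambda>t. - (finite_time_value \<tau> \<omega> p 0 t / t)) \<longlongrightarrow> H p) at_top"
      and freq: "\<exists>\<^sub>F n in sequentially. (\<forall>x\<in>{x}.
        \<bar>passage \<omega> 0 (- r (real n *\<^sub>R x)) / real n - m x\<bar> < e) \<and> 0 < n"
      using AE_ex[OF AE_hamiltonian[of "{x}" e p]] e by blast
    interpret bounded_environment a b \<tau> \<omega>
      using \<omega>(1) by (rule good_environment)
    have top: "filterlim (\<lambda>n. real n * c) at_top sequentially"
      by (rule filterlim_at_top_mult_tendsto_pos[OF tendsto_const c filterlim_real_sequentially])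
    have "p \<bullet> x / c - 0 \<le> H p"
    proof (rule frequently_le_limit[OF filterlim_compose[OF \<omega>(2) top]])
      show "(\<lambda>n. p \<bullet> x / c - (norm p * K / c) / real n) \<longlonglongrightarrow> p \<bullet> x / c - 0"
        by (intro tendsto_diff tendsto_const lim_const_over_n)
      show "\<exists>\<^sub>F n in sequentially. p \<bullet> x / c - (norm p * K / c) / real n
          \<le> - (finite_time_value \<tau> \<omega> p 0 (real n * c) / (real n * c))"
        using freq
      proof (rule frequently_elim1)
        fix n assume n: "(\<forall>x\<in>{x}. \<bar>passage \<omega> 0 (- r (real n *\<^sub>R x)) / real n - m x\<bar> < e) \<and> 0 < n"
        let ?v = "latvec (r (real n *\<^sub>R x))"
        have "passage \<omega> 0 (- r (real n *\<^sub>R x)) / real n < c"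
          using n by (auto simp: c_def abs_less_iff)
        then have "passage \<omega> 0 (- r (real n *\<^sub>R x)) < real n * c"
          using n by (simp add: divide_less_eq mult.commute)
        then obtain \<gamma> where \<gamma>: "nn_path \<gamma>" "hd \<gamma> = 0" "last \<gamma> = - r (real n *\<^sub>R x)"
          "path_weight \<tau> \<omega> \<gamma> < real n * c"
          unfolding passage_time_less_iff by blast
        have "p \<bullet> (real n *\<^sub>R x - ?v) \<le> norm p * norm (real n *\<^sub>R x - ?v)"
          by (rule norm_cauchy_schwarz)
        also have "\<dots> \<le> norm p * K"
          using rounding by (intro mult_left_mono) (auto simp: norm_minus_commute)
        finally have "real n * (p \<bullet> x) - norm p * K \<le> p \<bullet> ?v"
          by (simp add: inner_diff_right)
        also have "\<dots> \<le> - finite_time_value \<tau> \<omega> p 0 (real n * c)"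
          using finite_time_value_le[OF \<omega>(1) \<gamma>(1,2), of "real n * c" p] \<gamma>(3,4)
          by (simp add: latvec_minus)
        finally have "p \<bullet> x - (norm p * K) / real n
            \<le> - finite_time_value \<tau> \<omega> p 0 (real n * c) / real n"
          using n by (intro divide_by_n_ge) auto
        then have "(p \<bullet> x - (norm p * K) / real n) / c
            \<le> (- finite_time_value \<tau> \<omega> p 0 (real n * c) / real n) / c"
          using c by (intro divide_right_mono) auto
        then show "p \<bullet> x / c - (norm p * K / c) / real n
            \<le> - (finite_time_value \<tau> \<omega> p 0 (real n * c) / (real n * c))"
          by (simp add: diff_divide_distrib mult.commute)
      qed
    qed
    then show ?thesis
      by (simp add: c_def)
  qed
  show ?thesis
  proof (rule tendsto_lowerbound)
    show "((\<lambda>e. H p * (m x + e)) \<longlongrightarrow> H p * m x) (at_right 0)"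
      by (auto intro!: tendsto_eq_intros)
    show "\<forall>\<^sub>F e in at_right 0. p \<bullet> x \<le> H p * (m x + e)"
      using eventually_at_right_less[of 0]
    proof eventually_elim
      case (elim e)
      have "0 \<le> a * norm x"
        using a_pos by simp
      then have "0 < m x + e"
        using time_constant_ge[of x] elim by simp
      with *[OF elim] show ?case
        by (simp add: divide_le_eq)
    qed
  qed simp
qed

text \<open>If \<open>p\<close> lies in the dual unit ball, no path of weight at most \<open>n\<close> gains more than about \<open>n\<close>. The
endpoint of such a path depends on the environment, but after division by \<open>n\<close> it lies in a fixed
compact ball. On a finite net of this ball all passage times are close to their limits
simultaneously, and the Lipschitz estimate transfers this to the endpoint.\<close>

lemma hamiltonian_le_1:
  assumes dual: "\<And>x. p \<bullet> x \<le> m x"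
  shows "H p \<le> 1"
proof -
  \<comment> \<open>The three errors come from the passage times on the net, from moving the endpoint to the net,
    and from the change of the linear functional under that move.\<close>
  define C where "C = 1 + D + norm p"
  have *: "H p \<le> 1 + e * C" if e: "0 < e" for e
  proof -
    have "compact (cball (0 :: real ^ 'd) (1 / a))"
      by simp
    then obtain S where S: "finite S" "cball 0 (1 / a) \<subseteq> (\<Union>z\<in>S. ball (z :: real ^ 'd) e)"
      using e unfolding compact_eq_totally_bounded by blast
    obtain \<omega> where \<omega>: "\<omega> \<in> good"
      "((\<lambda>t. - (finite_time_value \<tau> \<omega> p 0 t / t)) \<longlongrightarrow> H p) at_top"
      and freq: "\<exists>\<^sub>F n in sequentially. (\<forall>x\<in>S.
        \<bar>passage \<omega> 0 (- r (real n *\<^sub>R x)) / real n - m x\<bar> < e) \<and> 0 < n"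
      using AE_ex[OF AE_hamiltonian[OF S(1) e, of p]] by blast
    interpret bounded_environment a b \<tau> \<omega>
      using \<omega>(1) by (rule good_environment)
    have "H p \<le> 1 + e * C + 0"
    proof (rule frequently_le_limit[OF _ filterlim_compose[OF \<omega>(2) filterlim_real_sequentially]])
      show "(\<lambda>n. 1 + e * C + D * K / real n) \<longlonglongrightarrow> 1 + e * C + 0"
        by (intro tendsto_add tendsto_const lim_const_over_n)
      show "\<exists>\<^sub>F n in sequentially.
          - (finite_time_value \<tau> \<omega> p 0 (real n) / real n) \<le> 1 + e * C + D * K / real n"
        using freq
      proof (rule frequently_elim1)
        fix n assume n: "(\<forall>x\<in>S. \<bar>passage \<omega> 0 (- r (real n *\<^sub>R x)) / real n - m x\<bar> < e) \<and> 0 < n"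
        have "- (real n * (1 + e * C) + D * K) \<le> finite_time_value \<tau> \<omega> p 0 (real n)"
        proof (rule finite_time_value_ge)
          fix \<gamma> assume \<gamma>: "nn_path \<gamma>" "hd \<gamma> = 0" "path_weight \<tau> \<omega> \<gamma> \<le> real n"
          define y where "y = latvec (last \<gamma>)"
          have "norm y \<le> real n / a"
            unfolding y_def by (rule endpoint_norm_le[OF \<omega>(1) \<gamma>])
          then have "norm (- (y /\<^sub>R real n)) \<le> 1 / a"
            using n a_pos by (simp add: field_simps)
          then have "- (y /\<^sub>R real n) \<in> (\<Union>z\<in>S. ball z e)"
            by (intro subsetD[OF S(2)]) simp
          then obtain z where z: "z \<in> S" "dist z (- (y /\<^sub>R real n)) < e"
            by auto
          have "real n * dist z (- (y /\<^sub>R real n)) = norm (real n *\<^sub>R (z + y /\<^sub>R real n))"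
            by (simp add: dist_norm)
          also have "real n *\<^sub>R (z + y /\<^sub>R real n) = real n *\<^sub>R z + y"
            using n by (simp add: scaleR_add_right)
          finally have near: "norm (real n *\<^sub>R z + y) \<le> real n * e"
            using z(2) n by (metis less_imp_le mult_left_mono of_nat_0_le_iff)
          have "latvec (- r (real n *\<^sub>R z)) - latvec (last \<gamma>)
              = (real n *\<^sub>R z - latvec (r (real n *\<^sub>R z))) - (real n *\<^sub>R z + y)"
            by (simp add: latvec_minus y_def)
          also have "norm \<dots> \<le> K + real n * e"
            using near rounding[of "real n *\<^sub>R z"]
            by (intro order_trans[OF norm_triangle_ineq4 add_mono]) (simp_all only: norm_minus_commute)
          finally have "passage \<omega> 0 (- r (real n *\<^sub>R z)) - passage \<omega> 0 (last \<gamma>)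
              \<le> D * (K + real n * e)"
            by (rule passage_time_diff_le(2)[OF \<omega>(1)])
          moreover have "passage \<omega> 0 (last \<gamma>) \<le> real n"
            using passage_time_le_weight[OF \<gamma>(1)] \<gamma>(2,3) by simp
          moreover have "real n * (m z - e) \<le> passage \<omega> 0 (- r (real n *\<^sub>R z))"
          proof -
            have "m z - e \<le> passage \<omega> 0 (- r (real n *\<^sub>R z)) / real n"
              using n z(1) by (smt (verit, ccfv_threshold))
            then show ?thesis
              using n by (simp add: le_divide_eq mult.commute)
          qed
          moreover have "real n * (p \<bullet> z) \<le> real n * m z"
            using dual by (intro mult_left_mono) auto
          moreover have "- (p \<bullet> y) \<le> real n * (p \<bullet> z) + norm p * (real n * e)"
          proof -
            have "- (p \<bullet> (real n *\<^sub>R z + y)) \<le> norm p * norm (real n *\<^sub>R z + y)"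
              using norm_cauchy_schwarz[of "- p" "real n *\<^sub>R z + y"] by simp
            also have "\<dots> \<le> norm p * (real n * e)"
              using near by (intro mult_left_mono) auto
            finally show ?thesis
              by (simp add: inner_add_right)
          qed
          ultimately show "- (real n * (1 + e * C) + D * K) \<le> p \<bullet> latvec (last \<gamma>)"
            by (simp add: C_def y_def algebra_simps)
        qed simp
        then have "- finite_time_value \<tau> \<omega> p 0 (real n) / real n \<le> (1 + e * C) + D * K / real n"
          using n by (intro divide_by_n_le) auto
        then show "- (finite_time_value \<tau> \<omega> p 0 (real n) / real n) \<le> 1 + e * C + D * K / real n"
          by simp
      qed
    qed
    then show ?thesis by simp
  qed
  show ?thesis
  proof (rule tendsto_lowerbound)
    show "((\<lambda>e. 1 + e * C) \<longlongrightarrow> 1) (at_right 0)"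
      by (auto intro!: tendsto_eq_intros)
    show "\<forall>\<^sub>F e in at_right 0. H p \<le> 1 + e * C"
      using eventually_at_right_less[of 0] by eventually_elim (rule *)
  qed simp
qed

lemma viscosity_solution_time_constant: "viscosity_solution (- {0}) (\<lambda>x u p. H p - 1) m"
proof (rule viscosity_solution_dual_norm)
  show "0 < m x" if "x \<noteq> 0" for x
    using time_constant_ge[of x] that a_pos by (smt (verit) mult_pos_pos zero_less_norm_iff)
qed (use time_constant_continuous time_constant_subadditive time_constant_homogeneous
  inner_le_hamiltonian_times_time_constant hamiltonian_le_1 in auto)

end

end

theorem theorem1p3:
  fixes M :: "'w measure"
    and V :: "int ^ 'd::finite \<Rightarrow> 'w \<Rightarrow> 'w"
    and \<tau> :: "int ^ 'd \<Rightarrow> int ^ 'd \<Rightarrow> 'w \<Rightarrow> real"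
    and a b :: real
    and r :: "real ^ 'd \<Rightarrow> int ^ 'd"
    and m H :: "real ^ 'd \<Rightarrow> real"
  assumes "stationary_ergodic_weights M V \<tau>"
    and "weight_essinf M \<tau> = ereal a" and "0 < a"
    and "weight_esssup M \<tau> = ereal b"
    and "closest_lattice_point r"
    and "is_time_constant M \<tau> r m"
    and "is_limiting_hamiltonian M \<tau> H"
  shows "viscosity_solution (- {0}) (\<lambda>x u p. H p - 1) m \<and> m 0 = 0"
proof -
  interpret stationary_ergodic_weights M V \<tau>
    by (rule assms(1))
  interpret homogenized_weights M V \<tau> a b r m
    using assms(2-6) by unfold_locales
  show ?thesis
    using viscosity_solution_time_constant[OF assms(7)] time_constant_zero by blast
qed

end
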